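(* Let $m\in\mathbb N$. There exists a number $K(m)$ such that for every $r<m$, no deterministic online algorithm for Online Makespan Hypergraph Coloring with $m$ colors is $r$-competitive, even when the instances are restricted to hyperforests with $K(m)$ hyperedges.
   Context: Online Makespan Hypergraph Coloring with $m$ colors: a hypergraph $\mathcal H=(V,E)$ with nodes $V=[n]$ is revealed online; nodes are revealed in the order $1,2,\dots,n$, and when node $j$ is revealed the algorithm learns the partial hyperedges $e\cap[j]$ for all $e\in E$, and must then irrevocably assign $j$ a color $c(j)\in[m]$. The objective (makespan) is $\max_{i\in[m]}\max_{e\in E}|c^{-1}(i)\cap e|$, to be minimized. (This is the unit-processing-time case of online makespan scheduling under scenarios, with nodes as jobs, hyperedges as scenarios and colors as machines.) A deterministic online algorithm is $r$-competitive if on every instance its objective value is at most $r$ times the minimum objective over all colorings $[n]\to[m]$. A hypercycle is a sequence $v_1,e_1,v_2,\dots,e_\ell,v_{\ell+1}=v_1$ with pairwise distinct hyperedges $e_t$ such that $v_t,v_{t+1}\in e_t$ for all $t\in[\ell]$; a hyperforest is a hypergraph without a hypercycle.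
   Formalization: A hypercycle is taken in Berge's sense (length at least 2, nodes v_1,…,v_ℓ pairwise distinct); with the literal definition every nonempty hyperedge would already form a hypercycle v,e,v and the claim would be false. *)

theory Defs
  imports Complex_Main "HOL-Library.FuncSet"
begin

text \<open>
  A hypergraph on the nodes \<open>{1..n}\<close> is given by its edge set \<open>E \<subseteq> Pow {1..n}\<close>.

  A hypercycle is understood in the sense of Berge: the nodes \<open>v\<^sub>1, \<dots>, v\<^sub>\<ell>\<close> are pairwise distinct and
  \<open>\<ell> \<ge> 2\<close>. Without this, \<open>v, e, v\<close> would be a hypercycle for every \<open>v \<in> e\<close>, and \<open>v, e, v, f, v\<close> would be
  one for any two edges sharing a node. The list \<open>vs\<close> is \<open>[v\<^sub>1, \<dots>, v\<^sub>\<ell>, v\<^sub>\<ell>\<^sub>+\<^sub>1]\<close>.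
\<close>

definition hypercycle :: "nat set set \<Rightarrow> nat list \<Rightarrow> nat set list \<Rightarrow> bool" where
  "hypercycle E vs es \<longleftrightarrow>
     2 \<le> length es \<and> length vs = length es + 1 \<and>
     vs ! length es = vs ! 0 \<and> distinct (butlast vs) \<and>
     distinct es \<and> set es \<subseteq> E \<and>
     (\<forall>t<length es. vs ! t \<in> es ! t \<and> vs ! (t + 1) \<in> es ! t)"

definition hyperforest :: "nat set set \<Rightarrow> bool" where
  "hyperforest E \<longleftrightarrow> (\<nexists>vs es. hypercycle E vs es)"

text \<open>\<open>SUP\<close> on \<^typ>\<open>nat\<close> is the maximum for finite nonempty sets and \<open>0\<close> for the empty set.\<close>

definition makespan :: "nat \<Rightarrow> nat set set \<Rightarrow> (nat \<Rightarrow> nat) \<Rightarrow> nat" where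
  "makespan m E c = (SUP i\<in>{1..m}. SUP e\<in>E. card (c -` {i} \<inter> e))"

definition opt_makespan :: "nat \<Rightarrow> nat \<Rightarrow> nat set set \<Rightarrow> nat" where
  "opt_makespan m n E = Min (makespan m E ` ({1..n} \<rightarrow>\<^sub>E {1..m}))"

text \<open>
  An instance \<open>(n, es)\<close> is the hypergraph with nodes \<open>{1..n}\<close> and edge set \<open>set es\<close>. The order of the list
  serves only to identify the edges, so that the algorithm sees the family of the
  partial hyperedges \<open>e \<inter> {1..j}\<close> indexed by the edges, rather than the set of these traces, in which
  edges with equal traces would be merged.
\<close>

definition instances :: "(nat \<times> nat set list) set" where
  "instances = {(n, es). distinct es \<and> set es \<subseteq> Pow {1..n}}"

definition hyperforest_instances :: "nat \<Rightarrow> (nat \<times> nat set list) set" where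
  "hyperforest_instances K =
     {(n, es) \<in> instances. hyperforest (set es) \<and> card (set es) = K}"

text \<open>
  A deterministic online algorithm maps the current node \<open>j\<close> and the partial hyperedges \<open>e \<inter> {1..j}\<close> to
  a color. It need not be given the earlier partial hyperedges \<open>e \<inter> {1..i}\<close>, \<open>i < j\<close>, nor its own earlier
  colors: both are determined by this input.
\<close>

type_synonym algorithm = "nat \<Rightarrow> nat set list \<Rightarrow> nat"

definition online_algorithm :: "nat \<Rightarrow> algorithm \<Rightarrow> bool" where
  "online_algorithm m A \<longleftrightarrow> (\<forall>j ps. A j ps \<in> {1..m})"

definition online_coloring :: "algorithm \<Rightarrow> nat set list \<Rightarrow> nat \<Rightarrow> nat" where
  "online_coloring A es j = A j (map (\<lambda>e. e \<inter> {1..j}) es)"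

definition competitive_on ::
    "(nat \<times> nat set list) set \<Rightarrow> nat \<Rightarrow> real \<Rightarrow> algorithm \<Rightarrow> bool" where
  "competitive_on I m r A \<longleftrightarrow>
     (\<forall>(n, es)\<in>I. real (makespan m (set es) (online_coloring A es))
                    \<le> r * real (opt_makespan m n (set es)))"

end

theory Submission imports Defs "HOL-Combinatorics.Transposition" begin

text \<open>
  A hyperforest whose edges have at most \<open>m\<close> nodes has a coloring that is injective on every edge, so
  the optimum is at most \<open>1\<close>, and the adversary only has to force a monochromatic edge of size \<open>m\<close>.
  It keeps a large stock of monochromatic edges of each color \<open>i\<close> and some size \<open>k i\<close>, all in
  different components (empty edges count for any color). A new node is put into one edge from every
  stock: whatever color \<open>c\<close> it receives, the edge from the \<open>c\<close>-th stock grows to size \<open>k c + 1\<close>. After many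
  such nodes the pigeonhole principle gives a color \<open>c\<close> whose size \<open>k c\<close> can be raised by one while the
  other sizes are kept, at the cost of a factor \<open>m + 1\<close> in the stocks, and at most \<open>m\<^sup>2\<close> rounds suffice.
  Finally all edges are filled up to size \<open>m\<close>, which makes them distinct as sets if \<open>m \<ge> 2\<close>.
\<close>

section \<open>Forest labellings: acyclicity as a counting inequality\<close>

text \<open>
  The label \<open>q i\<close> is the component of the edge \<open>E i\<close>. The inequality says that every induced subgraph of
  the bipartite incidence graph has at least as many vertices as incidences and components together,
  which fails for a cycle; it is preserved when a node is added to edges with different labels.
\<close>

definition forest_labelling :: "nat \<Rightarrow> (nat \<Rightarrow> nat set) \<Rightarrow> (nat \<Rightarrow> nat) \<Rightarrow> bool" where
  "forest_labelling K E q \<longleftrightarrow>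
     (\<forall>W F. finite W \<longrightarrow> F \<subseteq> {..<K} \<longrightarrow>
        (\<Sum>i\<in>F. card (W \<inter> E i)) + card (q ` F) \<le> card W + card F)"

definition rainbow_coloring :: "nat \<Rightarrow> nat \<Rightarrow> (nat \<Rightarrow> nat set) \<Rightarrow> (nat \<Rightarrow> nat) \<Rightarrow> bool" where
  "rainbow_coloring m K E f \<longleftrightarrow> (\<forall>u. f u \<in> {1..m}) \<and> (\<forall>i<K. inj_on f (E i))"

definition add_node :: "nat \<Rightarrow> nat set \<Rightarrow> (nat \<Rightarrow> nat set) \<Rightarrow> nat \<Rightarrow> nat set" where
  "add_node v I E i = (if i \<in> I then insert v (E i) else E i)"

text \<open>The components met by a new node become one. \<open>Min\<close> just picks one of their
  old labels, so the merged label cannot clash with that of an untouched component.\<close>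

definition merge_labels :: "nat set \<Rightarrow> (nat \<Rightarrow> nat) \<Rightarrow> nat \<Rightarrow> nat" where
  "merge_labels I q i = (if q i \<in> q ` I then Min (q ` I) else q i)"

lemma forest_labellingD:
  assumes "forest_labelling K E q" "finite W" "F \<subseteq> {..<K}"
  shows "(\<Sum>i\<in>F. card (W \<inter> E i)) + card (q ` F) \<le> card W + card F"
  using assms unfolding forest_labelling_def by blast

lemma forest_labelling_empty:
  assumes "\<And>i. i < K \<Longrightarrow> E i = {}"
  shows "forest_labelling K E q"
  unfolding forest_labelling_def
proof (intro allI impI)
  fix W F :: "nat set" assume "finite W" and F: "F \<subseteq> {..<K}"
  have "(\<Sum>i\<in>F. card (W \<inter> E i)) = 0" using F assms by (intro sum.neutral) auto
  moreover have "card (q ` F) \<le> card F" using F finite_subset by (intro card_image_le) auto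
  ultimately show "(\<Sum>i\<in>F. card (W \<inter> E i)) + card (q ` F) \<le> card W + card F" by simp
qed

text \<open>Different labels would give 2 incidences and 2 labels against 1 node and 2
  edges.\<close>

lemma forest_labelling_same_component:
  assumes "forest_labelling K E q" "i < K" "j < K" "u \<in> E i" "u \<in> E j"
  shows "q i = q j"
proof (rule ccontr)
  assume ne: "q i \<noteq> q j"
  then have "i \<noteq> j" by auto
  then show False
    using forest_labellingD[OF assms(1), of "{u}" "{i, j}"] assms ne by simp
qed

text \<open>Two shared nodes form a 4-cycle in the incidence graph: 4 incidences and at least one
  label against 2 nodes and 2 edges. A single shared node would not suffice.\<close>

lemma forest_labelling_edges_distinct:
  assumes q: "forest_labelling K E q" and "i < K" "j < K" "i \<noteq> j" and "2 \<le> card (E i)"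
  shows "E i \<noteq> E j"
proof
  assume eq: "E i = E j"
  obtain W where W: "W \<subseteq> E i" "card W = 2" "finite W"
    using obtain_subset_with_card_n[OF assms(5)] by auto
  have "W \<inter> E i = W" "W \<inter> E j = W" using W eq by auto
  moreover have "card (q ` {i, j}) > 0" by (simp add: card_gt_0_iff)
  ultimately show False
    using forest_labellingD[OF q W(3), of "{i, j}"] W assms by simp
qed

text \<open>A node \<open>v\<close> in \<open>W\<close> brings one node and
  \<open>card (F \<inter> I)\<close> incidences. The edges in \<open>F \<inter> I\<close> had
  different labels that now collapse into one, so the loss of labels pays for all but one of these
  incidences, and the new node pays for the last.\<close>

lemma forest_labelling_add_node:
  assumes q: "forest_labelling K E q" and v: "\<And>i. i < K \<Longrightarrow> v \<notin> E i"
    and I: "I \<subseteq> {..<K}" and inj: "inj_on q I"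
  shows "forest_labelling K (add_node v I E) (merge_labels I q)"
  unfolding forest_labelling_def
proof (intro allI impI)
  fix W F :: "nat set" assume W: "finite W" and F: "F \<subseteq> {..<K}"
  have finF: "finite F" using F finite_subset by auto
  have finI: "finite I" using I finite_subset by auto
  let ?r = "merge_labels I q"
  have le: "card (?r ` F) \<le> card (q ` F)"
  proof -
    have "?r ` F = (\<lambda>k. if k \<in> q ` I then Min (q ` I) else k) ` q ` F"
      unfolding image_image by (intro image_cong) (auto simp: merge_labels_def)
    then show ?thesis using finF by (simp only: card_image_le finite_imageI)
  qed
  show "(\<Sum>i\<in>F. card (W \<inter> add_node v I E i)) + card (?r ` F) \<le> card W + card F"
  proof (cases "v \<in> W")
    case False
    then have "(\<Sum>i\<in>F. card (W \<inter> add_node v I E i)) = (\<Sum>i\<in>F. card (W \<inter> E i))"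
      by (intro sum.cong) (auto simp: add_node_def)
    then show ?thesis using forest_labellingD[OF q W F] le by simp
  next
    case True
    let ?W = "W - {v}"
    have "(\<Sum>i\<in>F. card (W \<inter> add_node v I E i))
        = (\<Sum>i\<in>F. card (?W \<inter> E i) + (if i \<in> I then 1 else 0))"
    proof (intro sum.cong refl)
      fix i assume "i \<in> F"
      then have vi: "v \<notin> E i" using v F by auto
      show "card (W \<inter> add_node v I E i) = card (?W \<inter> E i) + (if i \<in> I then 1 else 0)"
      proof (cases "i \<in> I")
        case iI: True
        have "W \<inter> add_node v I E i = insert v (?W \<inter> E i)"
          using iI True vi by (auto simp: add_node_def)
        then show ?thesis using iI W by simp
      next
        case False
        have "W \<inter> add_node v I E i = ?W \<inter> E i"
          using False vi by (auto simp: add_node_def)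
        then show ?thesis using False by simp
      qed
    qed
    also have "\<dots> = (\<Sum>i\<in>F. card (?W \<inter> E i)) + card (F \<inter> I)"
      using finF by (simp add: sum.distrib sum.If_cases Int_def)
    finally have s: "(\<Sum>i\<in>F. card (W \<inter> add_node v I E i))
        = (\<Sum>i\<in>F. card (?W \<inter> E i)) + card (F \<inter> I)" .
    have "card (F \<inter> I) + card (?r ` F) \<le> 1 + card (q ` F)"
    proof (cases "F \<inter> I = {}")
      case True
      then show ?thesis using le by simp
    next
      case False
      have "?r ` F \<subseteq> insert (Min (q ` I)) (q ` F - q ` I)"
        by (auto simp: merge_labels_def)
      then have "card (?r ` F) \<le> card (insert (Min (q ` I)) (q ` F - q ` I))"
        using finF by (intro card_mono) auto
      then have 1: "card (?r ` F) \<le> 1 + card (q ` F - q ` I)"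
        using finF by (simp add: card_insert_if split: if_splits)
      have "card (F \<inter> I) = card (q ` (F \<inter> I))"
        using inj by (metis card_image inj_on_subset inf_le2)
      also have "\<dots> \<le> card (q ` F \<inter> q ` I)" using finF by (intro card_mono) auto
      finally have "card (F \<inter> I) \<le> card (q ` F \<inter> q ` I)" .
      moreover have "card (q ` F) = card (q ` F \<inter> q ` I) + card (q ` F - q ` I)"
        using finF by (metis Int_Diff_disjoint Int_Diff_Un card_Un_disjoint finite_Diff finite_Int
            finite_imageI)
      ultimately show ?thesis using 1 by simp
    qed
    moreover have "card W = card ?W + 1" using True W
      by (metis Suc_eq_plus1 card_Suc_Diff1)
    ultimately show ?thesis using forest_labellingD[OF q _ F, of ?W] W s by simp
  qed
qed

text \<open>Take \<open>W\<close> and \<open>F\<close> to be the \<ell> nodes and \<ell> edges of a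
  cycle. Each edge contains two of the nodes, so 2\<ell> incidences and at least one label face only
  2\<ell> vertices.\<close>

lemma hyperforest_of_forest_labelling:
  assumes q: "forest_labelling K E q"
  shows "hyperforest (E ` {..<K})"
  unfolding hyperforest_def
proof clarify
  fix vs es assume cyc: "hypercycle (E ` {..<K}) vs es"
  let ?l = "length es"
  have l: "2 \<le> ?l" "length vs = ?l + 1" "vs ! ?l = vs ! 0" "distinct (butlast vs)" "distinct es"
    "set es \<subseteq> E ` {..<K}"
    and inc: "\<And>t. t < ?l \<Longrightarrow> vs ! t \<in> es ! t \<and> vs ! (t + 1) \<in> es ! t"
    using cyc unfolding hypercycle_def by auto
  \<comment> \<open>\<open>E\<close> may repeat sets, so one index is selected for each edge of the
    cycle.\<close>
  obtain F where F: "F \<subseteq> {..<K}" "inj_on E F" "E ` F = set es"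
    using l(6) unfolding subset_image_inj by metis
  let ?W = "set (butlast vs)"
  have cW: "card ?W = ?l" using l distinct_card[OF l(4)] by simp
  have cF: "card F = ?l" using F l(5) by (metis card_image distinct_card)
  have nthW: "vs ! t \<in> ?W" if "t < ?l" for t
  proof -
    have "t < length (butlast vs)" using that l(2) by simp
    then show ?thesis using nth_mem nth_butlast by metis
  qed
  have two: "2 \<le> card (?W \<inter> e)" if e: "e \<in> set es" for e
  proof -
    obtain t where t: "t < ?l" "e = es ! t" using e by (auto simp: in_set_conv_nth)
    \<comment> \<open>The cyclic successor of \<open>t\<close>: the closing node is replaced by its
      first occurrence, so that distinctness of \<open>butlast vs\<close> applies.
      \<open>s \<noteq> t\<close> needs length at least 2.\<close>
    define s where "s = (if t + 1 = ?l then 0 else t + 1)"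
    have s: "s < ?l" "s \<noteq> t" using t(1) l(1) unfolding s_def by auto
    have vs: "vs ! (t + 1) = vs ! s" using l(3) unfolding s_def by simp
    have "butlast vs ! s \<noteq> butlast vs ! t"
      using s t(1) l(2,4) by (simp add: nth_eq_iff_index_eq)
    then have ne: "vs ! s \<noteq> vs ! t"
      using s(1) t(1) l(2) by (simp add: nth_butlast)
    have "{vs ! s, vs ! t} \<subseteq> ?W \<inter> e" using nthW[OF s(1)] nthW[OF t(1)] inc[OF t(1)] vs t(2) by simp
    then have "card {vs ! s, vs ! t} \<le> card (?W \<inter> e)" by (intro card_mono) auto
    then show ?thesis using ne by simp
  qed
  have "2 * ?l = (\<Sum>i\<in>F. 2)" using cF by simp
  also have "\<dots> \<le> (\<Sum>i\<in>F. card (?W \<inter> E i))" using two F by (intro sum_mono) auto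
  finally have "2 * ?l \<le> (\<Sum>i\<in>F. card (?W \<inter> E i))" .
  moreover have "card (q ` F) > 0"
  proof -
    have "0 < card F" using cF l(1) by linarith
    then show ?thesis by (simp add: card_gt_0_iff)
  qed
  ultimately show False using forest_labellingD[OF q _ F(1), of ?W] cW cF by simp
qed

section \<open>Rainbow colorings and valid families\<close>

text \<open>Each edge in \<open>I\<close> has fewer than \<open>m\<close> nodes and so misses some
  color. These edges lie in different components, whose colors can be permuted
  independently.\<close>

lemma rainbow_coloring_add_node:
  assumes q: "forest_labelling K E q" and f: "rainbow_coloring m K E f"
    and v: "\<And>i. i < K \<Longrightarrow> v \<notin> E i" and fin: "\<And>i. i < K \<Longrightarrow> finite (E i)"
    and I: "I \<subseteq> {..<K}" and inj: "inj_on q I"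
    and small: "\<And>i. i \<in> I \<Longrightarrow> card (E i) < m" and m: "1 \<le> m"
  shows "\<exists>f'. rainbow_coloring m K (add_node v I E) f'"
proof -
  have fm: "f u \<in> {1..m}" for u using f by (auto simp: rainbow_coloring_def)
  have fi: "inj_on f (E i)" if "i < K" for i using f that by (auto simp: rainbow_coloring_def)
  have "\<exists>a\<in>{1..m}. a \<notin> f ` E i" if "i \<in> I" for i
  proof (rule ccontr)
    assume "\<not> ?thesis"
    then have "card {1..m} \<le> card (f ` E i)" using I that fin by (intro card_mono) auto
    also have "\<dots> \<le> card (E i)" using I that fin by (intro card_image_le) auto
    finally show False using small[OF that] by simp
  qed
  then obtain a where a: "\<And>i. i \<in> I \<Longrightarrow> a i \<in> {1..m} \<and> a i \<notin> f ` E i" by metis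
  txt \<open>Swap the colors in each component that \<open>v\<close> meets so that color \<open>1\<close> becomes free for \<open>v\<close>.\<close>
  define b where "b k = (if k \<in> q ` I then a (inv_into I q k) else 1)" for k
  have b: "b (q i) = a i" if "i \<in> I" for i using that inj by (simp add: b_def)
  have bm: "b k \<in> {1..m}" for k
    using a m inv_into_into[of k q I] by (auto simp: b_def)
  \<comment> \<open>The choice of edge is immaterial, since edges sharing a node carry the same
    label. The value at nodes in no edge is arbitrary.\<close>
  define lab where "lab u = q (SOME i. i < K \<and> u \<in> E i)" for u
  have lab: "lab u = q i" if "i < K" "u \<in> E i" for u i
  proof -
    have "(SOME i. i < K \<and> u \<in> E i) < K \<and> u \<in> E (SOME i. i < K \<and> u \<in> E i)"
      using that by (intro someI[of "\<lambda>i. i < K \<and> u \<in> E i"]) auto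
    then show ?thesis unfolding lab_def
      using forest_labelling_same_component[OF q] that by blast
  qed
  define g where "g u = (if u = v then 1 else transpose 1 (b (lab u)) (f u))" for u
  have g: "g u = transpose 1 (b (q i)) (f u)" if "i < K" "u \<in> E i" for i u
    using that v lab by (auto simp: g_def)
  have "g u \<in> {1..m}" for u
    using fm[of u] bm[of "lab u"] m by (auto simp: g_def transpose_def)
  moreover have gE: "inj_on g (E i)" if "i < K" for i
  proof -
    have "inj_on (transpose 1 (b (q i)) \<circ> f) (E i)"
      using fi[OF that] by (intro comp_inj_on) auto
    then show ?thesis using g[OF that] by (simp add: inj_on_def)
  qed
  moreover have "inj_on g (insert v (E i))" if "i \<in> I" for i
  proof -
    have iK: "i < K" using I that by auto
    have "g u \<noteq> 1" if u: "u \<in> E i" for u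
    proof -
      have "f u \<noteq> b (q i)" using a[OF \<open>i \<in> I\<close>] b[OF \<open>i \<in> I\<close>] imageI[OF u, of f] by auto
      then show ?thesis using g[OF iK u] by (auto simp: transpose_def)
    qed
    moreover have "g v = 1" by (simp add: g_def)
    ultimately have "g v \<notin> g ` (E i - {v})" by force
    then show ?thesis using gE[OF iK] by simp
  qed
  ultimately have "rainbow_coloring m K (add_node v I E) g"
    by (auto simp: rainbow_coloring_def add_node_def)
  then show ?thesis by blast
qed

text \<open>The part of the adversary's invariant that does not mention the algorithm: acyclicity
  and, through the rainbow coloring, optimum at most 1.\<close>

definition valid_family :: "nat \<Rightarrow> nat \<Rightarrow> nat \<Rightarrow> (nat \<Rightarrow> nat set) \<Rightarrow> (nat \<Rightarrow> nat) \<Rightarrow> bool" where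
  "valid_family m K n E q \<longleftrightarrow>
     (\<forall>i<K. E i \<subseteq> {1..n} \<and> card (E i) \<le> m) \<and> forest_labelling K E q \<and>
     (\<exists>f. rainbow_coloring m K E f)"

lemma valid_family_add_node:
  assumes V: "valid_family m K n E q" and I: "I \<subseteq> {..<K}" and inj: "inj_on q I"
    and small: "\<And>i. i \<in> I \<Longrightarrow> card (E i) < m" and m: "1 \<le> m"
  shows "valid_family m K (Suc n) (add_node (Suc n) I E) (merge_labels I q)"
proof -
  have E: "E i \<subseteq> {1..n}" "card (E i) \<le> m" if "i < K" for i
    using V that by (auto simp: valid_family_def)
  have fin: "finite (E i)" if "i < K" for i using E(1)[OF that] finite_subset by blast
  have new: "Suc n \<notin> E i" if "i < K" for i using E(1)[OF that] by auto
  obtain f where f: "rainbow_coloring m K E f" and q: "forest_labelling K E q"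
    using V by (auto simp: valid_family_def)
  have "add_node (Suc n) I E i \<subseteq> {1..Suc n} \<and> card (add_node (Suc n) I E i) \<le> m" if "i < K" for i
    using E[OF that] small[of i] fin[OF that] by (auto simp: add_node_def card_insert_if)
  then show ?thesis unfolding valid_family_def
    using forest_labelling_add_node[OF q new I inj]
      rainbow_coloring_add_node[OF q f new fin I inj small m] by simp
qed

section \<open>The adversary's strategy against an online algorithm\<close>

abbreviation family_coloring :: "algorithm \<Rightarrow> nat \<Rightarrow> (nat \<Rightarrow> nat set) \<Rightarrow> nat \<Rightarrow> nat" where
  "family_coloring A K E \<equiv> online_coloring A (map E [0..<K])"

text \<open>The color of \<open>u\<close> depends only on traces on \<open>{1..u}\<close>, which a
  later node leaves unchanged. This lets the instance be built adaptively.\<close>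

lemma family_coloring_add_node:
  assumes "u < v"
  shows "family_coloring A K (add_node v I E) u = family_coloring A K E u"
proof -
  have "map (\<lambda>e. e \<inter> {1..u}) (map (add_node v I E) [0..<K])
      = map (\<lambda>e. e \<inter> {1..u}) (map E [0..<K])"
    using assms by (auto simp: add_node_def)
  then show ?thesis by (simp only: online_coloring_def)
qed

text \<open>
  \<open>U\<close> holds the edges that are still useful, and \<open>\<tau> x\<close> is the only color on \<open>E x\<close>. For an empty edge
  \<open>\<tau> x\<close> is an arbitrary choice made in advance, so that \<open>\<tau>\<close> never changes.
\<close>

definition promising ::
    "algorithm \<Rightarrow> nat \<Rightarrow> nat \<Rightarrow> nat \<Rightarrow> (nat \<Rightarrow> nat set) \<Rightarrow> (nat \<Rightarrow> nat) \<Rightarrow> nat set \<Rightarrow> (nat \<Rightarrow> nat) \<Rightarrow> bool"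
  where
  "promising A m K n E q U \<tau> \<longleftrightarrow>
     valid_family m K n E q \<and> U \<subseteq> {..<K} \<and> inj_on q U \<and>
     (\<forall>x\<in>U. \<tau> x \<in> {1..m} \<and> (\<forall>u\<in>E x. family_coloring A K E u = \<tau> x))"

text \<open>The new node joins one edge per color. Only \<open>x c\<close>, where \<open>c\<close>
  is the answer, stays monochromatic; discarding the others also leaves just one useful edge in the
  merged component.\<close>

lemma promising_step:
  assumes A: "online_algorithm m A" and m: "1 \<le> m" and S: "promising A m K n E q U \<tau>"
    and x: "\<And>i. i \<in> {1..m} \<Longrightarrow> x i \<in> U \<and> \<tau> (x i) = i \<and> card (E (x i)) < m"
  shows "\<exists>c\<in>{1..m}. \<exists>q'. promising A m K (Suc n) (add_node (Suc n) (x ` {1..m}) E) q'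
           (U - x ` ({1..m} - {c})) \<tau>"
proof -
  let ?I = "x ` {1..m}" and ?v = "Suc n"
  let ?E = "add_node ?v ?I E" and ?q = "merge_labels ?I q"
  define c where "c = family_coloring A K ?E ?v"
  have c: "c \<in> {1..m}" using A by (simp add: c_def online_coloring_def online_algorithm_def)
  let ?U = "U - x ` ({1..m} - {c})"
  have V: "valid_family m K n E q" and U: "U \<subseteq> {..<K}" and inj: "inj_on q U"
    and mono: "\<And>y. y \<in> U \<Longrightarrow> \<tau> y \<in> {1..m} \<and> (\<forall>u\<in>E y. family_coloring A K E u = \<tau> y)"
    using S by (auto simp: promising_def)
  have IU: "?I \<subseteq> U" using x by auto
  have "valid_family m K ?v ?E ?q"
    using IU U x inj_on_subset[OF inj IU] by (intro valid_family_add_node[OF V _ _ _ m]) auto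
  moreover have "inj_on ?q ?U"
  proof -
    \<comment> \<open>Every survivor other than \<open>x c\<close> keeps its label, which differs
      from all labels that were merged.\<close>
    have out: "?q y = q y \<and> q y \<notin> q ` ?I" if "y \<in> ?U" "y \<noteq> x c" for y
    proof -
      have "y \<notin> ?I" using that by auto
      then have "q y \<notin> q ` ?I"
        using inj_on_image_mem_iff[OF inj _ IU, of y] that by simp
      then show ?thesis by (simp add: merge_labels_def)
    qed
    have "?q (x c) = Min (q ` ?I)" using c by (simp add: merge_labels_def)
    moreover have "Min (q ` ?I) \<in> q ` ?I" using m by (intro Min_in) auto
    ultimately have "?q (x c) \<in> q ` ?I" by simp
    then show ?thesis
      by (intro inj_onI) (metis out inj inj_onD DiffD1)
  qed
  moreover have "family_coloring A K ?E u = \<tau> y" if y: "y \<in> ?U" and u: "u \<in> ?E y" for y u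
  proof (cases "u = ?v")
    case True
    have "E y \<subseteq> {1..n}" using V U y by (auto simp: valid_family_def)
    then have "?v \<notin> E y" by auto
    then have "y \<in> ?I" using u True by (auto simp: add_node_def split: if_splits)
    then have "y = x c" using y by auto
    then show ?thesis using True c x c_def by auto
  next
    case False
    then have "u \<in> E y" using u by (auto simp: add_node_def split: if_splits)
    moreover from this have "u < ?v" using V U y by (fastforce simp: valid_family_def)
    ultimately show ?thesis using mono y by (simp add: family_coloring_add_node)
  qed
  ultimately have "promising A m K ?v ?E ?q ?U \<tau>"
    using U mono unfolding promising_def by auto
  then show ?thesis using c by blast
qed

definition stock :: "(nat \<Rightarrow> nat set) \<Rightarrow> nat set \<Rightarrow> (nat \<Rightarrow> nat) \<Rightarrow> nat \<Rightarrow> nat \<Rightarrow> nat set" where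
  "stock E U \<tau> i k = {x \<in> U. \<tau> x = i \<and> card (E x) = k}"

text \<open>Each step takes one edge from each stock and returns one grown edge. Grown edges have
  size \<open>Suc (k i)\<close>, so later steps, which use only edges of size \<open>k i\<close>,
  never touch them.\<close>

lemma promising_many_steps:
  assumes A: "online_algorithm m A" and m: "1 \<le> m" and S: "promising A m K n E q U \<tau>"
    and k: "\<And>i. i \<in> {1..m} \<Longrightarrow> k i < m"
    and M: "\<And>i. i \<in> {1..m} \<Longrightarrow> M \<le> card (stock E U \<tau> i (k i))"
    and "s \<le> M"
  shows "\<exists>n' E' q' U'. promising A m K n' E' q' U' \<tau> \<and>
           (\<forall>i\<in>{1..m}. M - s \<le> card (stock E' U' \<tau> i (k i))) \<and>
           s \<le> card {x \<in> U'. card (E' x) = Suc (k (\<tau> x))}"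
  using \<open>s \<le> M\<close>
proof (induction s)
  case 0
  show ?case using S M by (intro exI[of _ n] exI[of _ E] exI[of _ q] exI[of _ U]) simp
next
  case (Suc s)
  then obtain n E q U where S: "promising A m K n E q U \<tau>"
    and st: "\<And>i. i \<in> {1..m} \<Longrightarrow> M - s \<le> card (stock E U \<tau> i (k i))"
    and L: "s \<le> card {x \<in> U. card (E x) = Suc (k (\<tau> x))}"
    by auto
  have finU: "finite U" using S finite_subset[of U "{..<K}"] by (auto simp: promising_def)
  have "\<exists>y. y \<in> stock E U \<tau> i (k i)" if "i \<in> {1..m}" for i
  proof -
    have "0 < card (stock E U \<tau> i (k i))" using st[OF that] Suc.prems by simp
    then show ?thesis by (auto simp: card_gt_0_iff)
  qed
  then obtain x where "\<And>i. i \<in> {1..m} \<Longrightarrow> x i \<in> stock E U \<tau> i (k i)" by metis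
  then have x: "x i \<in> U" "\<tau> (x i) = i" "card (E (x i)) = k i" if "i \<in> {1..m}" for i
    using that by (auto simp: stock_def)
  let ?E = "add_node (Suc n) (x ` {1..m}) E"
  obtain c q' where c: "c \<in> {1..m}"
    and S': "promising A m K (Suc n) ?E q' (U - x ` ({1..m} - {c})) \<tau>"
    using promising_step[OF A m S, of x] x k by metis
  let ?U = "U - x ` ({1..m} - {c})"
  have "M - Suc s \<le> card (stock ?E ?U \<tau> i (k i))" if i: "i \<in> {1..m}" for i
  proof -
    have "stock E U \<tau> i (k i) - {x i} \<subseteq> stock ?E ?U \<tau> i (k i)"
      using x by (auto simp: stock_def add_node_def)
    then have "card (stock E U \<tau> i (k i) - {x i}) \<le> card (stock ?E ?U \<tau> i (k i))"
      using finU by (intro card_mono) (auto simp: stock_def)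
    moreover have "card (stock E U \<tau> i (k i)) - 1 \<le> card (stock E U \<tau> i (k i) - {x i})"
      by (metis diff_card_le_card_Diff finite.emptyI finite_insert card.empty card_insert_disjoint
          empty_iff One_nat_def)
    ultimately show ?thesis using st[OF i] by linarith
  qed
  moreover have "Suc s \<le> card {y \<in> ?U. card (?E y) = Suc (k (\<tau> y))}"
  proof -
    let ?L = "{y \<in> U. card (E y) = Suc (k (\<tau> y))}"
    have "E (x c) \<subseteq> {1..n}" using S x(1)[OF c] by (auto simp: promising_def valid_family_def)
    then have "finite (E (x c))" "Suc n \<notin> E (x c)" using finite_subset by auto
    then have grown: "card (?E (x c)) = Suc (k c)" using c x by (simp add: add_node_def)
    have "y \<notin> x ` {1..m}" if "y \<in> ?L" for y using that x by auto
    moreover have "x c \<in> ?U" using x c by auto metis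
    ultimately have "insert (x c) ?L \<subseteq> {y \<in> ?U. card (?E y) = Suc (k (\<tau> y))}"
      using grown x c by (auto simp: add_node_def)
    then have "card (insert (x c) ?L) \<le> card {y \<in> ?U. card (?E y) = Suc (k (\<tau> y))}"
      using finU by (intro card_mono) auto
    moreover have "x c \<notin> ?L" using x c by auto
    ultimately show ?thesis using L finU by simp
  qed
  ultimately show ?case using S' by blast
qed

text \<open>After \<open>m * N\<close> steps there are \<open>m * N\<close> grown edges, so some
  color \<open>c\<close> has \<open>N\<close> of them. Every other stock still has
  \<open>(m + 1) * N - m * N = N\<close> edges.\<close>

lemma promising_phase:
  assumes A: "online_algorithm m A" and m: "1 \<le> m" and S: "promising A m K n E q U \<tau>"
    and k: "\<And>i. i \<in> {1..m} \<Longrightarrow> k i < m"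
    and N: "\<And>i. i \<in> {1..m} \<Longrightarrow> (m + 1) * N \<le> card (stock E U \<tau> i (k i))"
  shows "\<exists>n' E' q' U'. \<exists>c\<in>{1..m}. promising A m K n' E' q' U' \<tau> \<and>
           (\<forall>i\<in>{1..m}. N \<le> card (stock E' U' \<tau> i ((k(c := Suc (k c))) i)))"
proof -
  obtain n' E' q' U' where S': "promising A m K n' E' q' U' \<tau>"
    and st: "\<And>i. i \<in> {1..m} \<Longrightarrow> (m + 1) * N - m * N \<le> card (stock E' U' \<tau> i (k i))"
    and L: "m * N \<le> card {x \<in> U'. card (E' x) = Suc (k (\<tau> x))}"
    using promising_many_steps[where s = "m * N", OF A m S k N] by auto
  have finU: "finite U'" using S' finite_subset[of U' "{..<K}"] by (auto simp: promising_def)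
  have "\<exists>c\<in>{1..m}. N \<le> card (stock E' U' \<tau> c (Suc (k c)))"
  proof (rule ccontr)
    assume "\<not> ?thesis"
    then have "\<And>c. c \<in> {1..m} \<Longrightarrow> card (stock E' U' \<tau> c (Suc (k c))) < N" by force
    then have lt: "(\<Sum>c\<in>{1..m}. card (stock E' U' \<tau> c (Suc (k c)))) < m * N"
      using sum_bounded_above_strict[of "{1..m}" "\<lambda>c. card (stock E' U' \<tau> c (Suc (k c)))" N] m
      by simp
    have "{x \<in> U'. card (E' x) = Suc (k (\<tau> x))} \<subseteq> (\<Union>c\<in>{1..m}. stock E' U' \<tau> c (Suc (k c)))"
      using S' by (auto simp: promising_def stock_def)
    then have "card {x \<in> U'. card (E' x) = Suc (k (\<tau> x))}
        \<le> card (\<Union>c\<in>{1..m}. stock E' U' \<tau> c (Suc (k c)))"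
      using finU by (intro card_mono) (auto simp: stock_def)
    also have "\<dots> \<le> (\<Sum>c\<in>{1..m}. card (stock E' U' \<tau> c (Suc (k c))))"
      by (intro card_UN_le) auto
    finally show False using lt L by simp
  qed
  then show ?thesis using S' st by (fastforce simp: algebra_simps)
qed

text \<open>\<open>T\<close> is the total number of size increments still missing. A phase lowers it
  by one and divides the guaranteed stocks by \<open>m + 1\<close>.\<close>

lemma promising_force:
  assumes A: "online_algorithm m A" and m: "1 \<le> m" and S: "promising A m K n E q U \<tau>"
    and "\<And>i. i \<in> {1..m} \<Longrightarrow> k i \<le> m"
    and "\<And>i. i \<in> {1..m} \<Longrightarrow> (m + 1) ^ T \<le> card (stock E U \<tau> i (k i))"
    and "(\<Sum>i\<in>{1..m}. m - k i) = T"
  shows "\<exists>n' E' q' U'. promising A m K n' E' q' U' \<tau> \<and> (\<exists>x\<in>U'. card (E' x) = m)"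
  using assms(3-)
proof (induction T arbitrary: n E q U k)
  case (0 n E q U k)
  have "1 \<in> {1..m}" using m by simp
  moreover from this have "m \<le> k 1"
    using 0(4) by (metis sum_eq_0_iff finite_atLeastAtMost diff_is_0_eq)
  ultimately have "k 1 = m" using 0(2) by (metis le_antisym)
  then have "0 < card (stock E U \<tau> 1 m)" using 0(3)[of 1] m by fastforce
  then obtain x where "x \<in> stock E U \<tau> 1 m" by (auto simp: card_gt_0_iff)
  then have "x \<in> U" "card (E x) = m" by (auto simp: stock_def)
  then show ?case using 0(1) by blast
next
  case (Suc T n E q U k)
  show ?case
  \<comment> \<open>A phase needs all sizes below \<open>m\<close>. Once some size equals
    \<open>m\<close>, any edge in that nonempty stock is the one sought.\<close>
  proof (cases "\<exists>i\<in>{1..m}. k i = m")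
    case True
    then obtain i where i: "i \<in> {1..m}" "k i = m" by blast
    have "0 < (m + 1) ^ Suc T" by simp
    also have "\<dots> \<le> card (stock E U \<tau> i m)" using Suc.prems(3)[OF i(1)] i(2) by simp
    finally have "0 < card (stock E U \<tau> i m)" .
    then obtain x where "x \<in> stock E U \<tau> i m" by (auto simp: card_gt_0_iff)
    then have "x \<in> U" "card (E x) = m" by (auto simp: stock_def)
    then show ?thesis using Suc.prems(1) by blast
  next
    case False
    then have k: "k i < m" if "i \<in> {1..m}" for i using Suc.prems(2)[OF that] that by force
    have N: "(m + 1) * (m + 1) ^ T \<le> card (stock E U \<tau> i (k i))" if "i \<in> {1..m}" for i
      using Suc.prems(3)[OF that] by (simp only: power_Suc)
    obtain n' E' q' U' c where c: "c \<in> {1..m}" and S': "promising A m K n' E' q' U' \<tau>"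
      and st: "\<And>i. i \<in> {1..m} \<Longrightarrow> (m + 1) ^ T \<le> card (stock E' U' \<tau> i ((k(c := Suc (k c))) i))"
      using promising_phase[OF A m Suc.prems(1) k N] by metis
    have "(\<Sum>i\<in>{1..m}. m - k i) = (m - k c) + (\<Sum>i\<in>{1..m} - {c}. m - k i)"
      using c by (simp add: sum.remove)
    moreover have "(\<Sum>i\<in>{1..m}. m - (k(c := Suc (k c))) i)
        = (m - Suc (k c)) + (\<Sum>i\<in>{1..m} - {c}. m - k i)"
      using c by (simp add: sum.remove)
    ultimately have "(\<Sum>i\<in>{1..m}. m - (k(c := Suc (k c))) i) = T"
      using Suc.prems(4) k[OF c] by simp
    moreover have "(k(c := Suc (k c))) i \<le> m" if "i \<in> {1..m}" for i
      using k[OF that] k[OF c] by auto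
    ultimately show ?thesis using Suc.IH[OF S' _ st] by blast
  qed
qed

section \<open>Completing the instance\<close>

text \<open>A node placed in a single edge merges no components. Filling deficient edges by such
  nodes one at a time lowers the total deficit, while \<open>E x\<close> is already full and its
  nodes, being earlier, keep their colors.\<close>

lemma valid_family_fill:
  assumes m: "1 \<le> m" and "valid_family m K n E q" and x: "x < K" and "card (E x) = m"
    and "\<And>u. u \<in> E x \<Longrightarrow> family_coloring A K E u = c"
  shows "\<exists>n' E' q'. valid_family m K n' E' q' \<and> (\<forall>i<K. card (E' i) = m) \<and>
           (\<forall>u\<in>E' x. family_coloring A K E' u = c)"
  using assms(2,4,5)
proof (induction "\<Sum>i<K. m - card (E i)" arbitrary: n E q rule: less_induct)
  case (less E n q)
  have bd: "E i \<subseteq> {1..n}" "card (E i) \<le> m" if "i < K" for i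
    using less.prems(1) that by (auto simp: valid_family_def)
  show ?case
  proof (cases "\<forall>i<K. card (E i) = m")
    case True
    then show ?thesis using less.prems by blast
  next
    case False
    then obtain i where i: "i < K" "card (E i) < m" using bd(2) by (meson le_neq_implies_less)
    let ?E = "add_node (Suc n) {i} E"
    have V: "valid_family m K (Suc n) ?E (merge_labels {i} q)"
      using i m by (intro valid_family_add_node[OF less.prems(1)]) auto
    have fin: "finite (E i)" "Suc n \<notin> E i" using bd(1)[OF i(1)] finite_subset by auto
    have "(\<Sum>j<K. m - card (?E j)) < (\<Sum>j<K. m - card (E j))"
    proof (rule sum_strict_mono_ex1)
      show "\<forall>j\<in>{..<K}. m - card (?E j) \<le> m - card (E j)"
        using fin by (auto simp: add_node_def)
      show "\<exists>j\<in>{..<K}. m - card (?E j) < m - card (E j)"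
        using fin i by (intro bexI[of _ i]) (auto simp: add_node_def)
    qed simp
    moreover have eq: "?E x = E x" using i less.prems(2) by (auto simp: add_node_def)
    moreover have "family_coloring A K ?E u = c" if "u \<in> ?E x" for u
    proof -
      have "u \<in> E x" using that eq by simp
      moreover from this have "u < Suc n" using bd(1)[OF x] by auto
      ultimately show ?thesis using less.prems(3) by (simp add: family_coloring_add_node)
    qed
    ultimately show ?thesis using less.hyps[OF _ V] less.prems(2) by metis
  qed
qed

lemma adversary:
  assumes A: "online_algorithm m A" and m: "1 \<le> m" and K: "K = m * (m + 1) ^ (m * m)"
  shows "\<exists>n E q c. \<exists>x<K. c \<in> {1..m} \<and> valid_family m K n E q \<and> (\<forall>i<K. card (E i) = m) \<and>
           (\<forall>u\<in>E x. family_coloring A K E u = c)"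
proof -
  \<comment> \<open>All sizes start at 0, so the total deficit is \<open>m * m\<close>; each of the
    \<open>m\<close> colors therefore needs \<open>(m + 1) ^ (m * m)\<close> empty edges.\<close>
  define B where "B = (m + 1) ^ (m * m)"
  have B: "0 < B" "K = m * B" using K by (auto simp: B_def)
  \<comment> \<open>Indices are cut into \<open>m\<close> blocks of length \<open>B\<close>, one per
    color; \<open>Suc\<close> because colors start at 1.\<close>
  define \<tau> where "\<tau> x = Suc (x div B)" for x
  let ?E = "\<lambda>i::nat. {} :: nat set"
  have "rainbow_coloring m K ?E (\<lambda>_. 1)" using m by (simp add: rainbow_coloring_def)
  then have "valid_family m K 0 ?E id"
    using forest_labelling_empty[of K ?E id] by (auto simp: valid_family_def)
  moreover have "\<tau> x \<in> {1..m}" if "x < K" for x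
    using that B by (simp add: \<tau>_def Suc_le_eq less_mult_imp_div_less)
  ultimately have S: "promising A m K 0 ?E id {..<K} \<tau>" by (simp add: promising_def)
  have "B \<le> card (stock ?E {..<K} \<tau> i 0)" if i: "i \<in> {1..m}" for i
  proof -
    have "{(i - 1) * B..<(i - 1) * B + B} \<subseteq> stock ?E {..<K} \<tau> i 0"
    proof
      fix x assume x: "x \<in> {(i - 1) * B..<(i - 1) * B + B}"
      have "x div B = i - 1" using x by (intro div_nat_eqI) (auto simp: algebra_simps)
      moreover have "(i - 1) * B + B \<le> K"
      proof -
        have "(i - 1) * B + B = i * B" using i by (cases i) auto
        then show ?thesis using i B by simp
      qed
      ultimately show "x \<in> stock ?E {..<K} \<tau> i 0"
        using x i by (auto simp: stock_def \<tau>_def)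
    qed
    then have "card {(i - 1) * B..<(i - 1) * B + B} \<le> card (stock ?E {..<K} \<tau> i 0)"
      by (intro card_mono) (auto simp: stock_def)
    then show ?thesis by simp
  qed
  then obtain n E q U x where S': "promising A m K n E q U \<tau>" and x: "x \<in> U" "card (E x) = m"
    using promising_force[OF A m S, of "\<lambda>_. 0" "m * m"] by (auto simp: B_def)
  have V: "valid_family m K n E q" and xK: "x < K" and c: "\<tau> x \<in> {1..m}"
    and mono: "\<And>u. u \<in> E x \<Longrightarrow> family_coloring A K E u = \<tau> x"
    using S' x by (auto simp: promising_def)
  show ?thesis using valid_family_fill[OF m V xK x(2) mono] c xK by blast
qed

section \<open>Makespan bounds and the competitive ratio\<close>

lemma makespan_ge:
  assumes "finite E" "\<And>e. e \<in> E \<Longrightarrow> finite e" "e \<in> E" "i \<in> {1..m}"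
  shows "card (c -` {i} \<inter> e) \<le> makespan m E c"
proof -
  have "card (c -` {i} \<inter> e) \<le> (SUP e\<in>E. card (c -` {i} \<inter> e))"
    using assms by (intro cSUP_upper) auto
  also have "\<dots> \<le> makespan m E c"
    unfolding makespan_def using assms(4)
    by (intro cSUP_upper[where f = "\<lambda>i. SUP e\<in>E. card (c -` {i} \<inter> e)"]) auto
  finally show ?thesis .
qed

lemma opt_makespan_le:
  assumes f: "\<And>u. f u \<in> {1..m}" and E: "E \<subseteq> Pow {1..n}" "E \<noteq> {}" and m: "1 \<le> m"
    and inj: "\<And>e. e \<in> E \<Longrightarrow> inj_on f e"
  shows "opt_makespan m n E \<le> 1"
proof -
  \<comment> \<open>The optimum ranges over extensional functions. The restriction is harmless
    because all edges lie in \<open>{1..n}\<close>.\<close>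
  let ?g = "restrict f {1..n}"
  have g: "?g \<in> {1..n} \<rightarrow>\<^sub>E {1..m}" using f by auto
  have "card (?g -` {i} \<inter> e) \<le> 1" if e: "e \<in> E" for i e
  proof -
    have en: "e \<subseteq> {1..n}" using E e by auto
    then have "finite (?g -` {i} \<inter> e)" using finite_subset by blast
    moreover have "u = w" if "u \<in> ?g -` {i} \<inter> e" "w \<in> ?g -` {i} \<inter> e" for u w
    proof -
      have "u \<in> e" "w \<in> e" "f u = i" "f w = i" using that en by (auto split: if_splits)
      then show ?thesis using inj_onD[OF inj[OF e], of u w] by simp
    qed
    ultimately show ?thesis unfolding One_nat_def by (subst card_le_Suc0_iff_eq) blast+
  qed
  then have "makespan m E ?g \<le> 1"
    unfolding makespan_def using E m by (intro cSUP_least) auto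
  moreover have "opt_makespan m n E \<le> makespan m E ?g"
    unfolding opt_makespan_def using g by (intro Min_le finite_imageI finite_PiE imageI) auto
  ultimately show ?thesis by simp
qed

lemma not_competitive_onI:
  assumes "(n, es) \<in> I" "m \<le> makespan m (set es) (online_coloring A es)"
    "opt_makespan m n (set es) \<le> 1" "1 \<le> m" "r < real m"
  shows "\<not> competitive_on I m r A"
proof
  assume "competitive_on I m r A"
  then have "real (makespan m (set es) (online_coloring A es)) \<le> r * real (opt_makespan m n (set es))"
    using assms(1) by (auto simp: competitive_on_def)
  then have "real m \<le> r * real (opt_makespan m n (set es))" using assms(2) by linarith
  \<comment> \<open>The cases are split because \<open>r\<close> may be negative: optimum 0 would
    force \<open>m \<le> 0\<close>, and optimum 1 would force \<open>m \<le> r\<close>.\<close>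
  moreover have "opt_makespan m n (set es) = 0 \<or> opt_makespan m n (set es) = 1"
    using assms(3) by linarith
  ultimately show False using assms(4,5) by auto
qed

text \<open>Edges of size 1 need not be distinct as sets, so \<open>m = 1\<close> is treated apart:
  the single edge \<open>{1}\<close> has makespan 1, and a cycle needs two edges.\<close>

lemma one_color_not_competitive:
  assumes A: "online_algorithm 1 A" and r: "r < 1"
  shows "\<not> competitive_on (hyperforest_instances 1) 1 r A"
proof (rule not_competitive_onI)
  have "length es \<le> 1" if "distinct es" "set es \<subseteq> {{1}}" for es :: "nat set list"
    using that card_mono[of "{{1}}" "set es"] by (simp add: distinct_card)
  then have "hyperforest {{1}}" unfolding hyperforest_def hypercycle_def by fastforce
  then show "(1, [{1}]) \<in> hyperforest_instances 1"
    by (simp add: hyperforest_instances_def instances_def)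
  have "online_coloring A [{1}] 1 = 1"
    using A by (simp add: online_algorithm_def online_coloring_def)
  then have "online_coloring A [{1}] -` {1} \<inter> {1} = {1}" by auto
  then show "1 \<le> makespan 1 (set [{1}]) (online_coloring A [{1}])"
    using makespan_ge[of "{{1}}" "{1}" 1 1 "online_coloring A [{1}]"] by simp
  show "opt_makespan 1 1 (set [{1}]) \<le> 1"
    by (intro opt_makespan_le[of "\<lambda>_. 1"]) auto
qed (use r in auto)

theorem theorem2:
  fixes m :: nat
  shows "\<exists>K::nat. \<forall>r::real. r < real m \<longrightarrow>
    \<not> (\<exists>A. online_algorithm m A \<and> competitive_on (hyperforest_instances K) m r A)"
proof -
  consider "m = 0" | "m = 1" | "2 \<le> m" by linarith
  then show ?thesis
  proof cases
    \<comment> \<open>Without colors there is no online algorithm at all.\<close>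
    case 1
    then show ?thesis by (auto simp: online_algorithm_def)
  next
    case 2
    then show ?thesis using one_color_not_competitive by auto
  next
    case m: 3
    define K where "K = m * (m + 1) ^ (m * m)"
    have "\<not> competitive_on (hyperforest_instances K) m r A"
      if r: "r < real m" and A: "online_algorithm m A" for r A
    proof -
      obtain n E q c x where x: "x < K" and c: "c \<in> {1..m}" and V: "valid_family m K n E q"
        and full: "\<And>i. i < K \<Longrightarrow> card (E i) = m"
        and mono: "\<And>u. u \<in> E x \<Longrightarrow> family_coloring A K E u = c"
        using adversary[OF A _ K_def] m by auto
      obtain f where f: "\<And>u. f u \<in> {1..m}" "\<And>i. i < K \<Longrightarrow> inj_on f (E i)"
        and q: "forest_labelling K E q" and En: "\<And>i. i < K \<Longrightarrow> E i \<subseteq> {1..n}"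
        using V by (auto simp: valid_family_def rainbow_coloring_def)
      let ?es = "map E [0..<K]"
      have set: "set ?es = E ` {..<K}" by (simp add: atLeast0LessThan)
      \<comment> \<open>Here \<open>m \<ge> 2\<close> enters: full edges have two nodes, so
        different indices give different sets and the instance has exactly \<open>K\<close>
        edges.\<close>
      have "distinct ?es"
        using forest_labelling_edges_distinct[OF q] full m
        by (force simp: distinct_map inj_on_def)
      moreover have Pow: "set ?es \<subseteq> Pow {1..n}" using En unfolding set by blast
      moreover have "hyperforest (set ?es)"
        unfolding set by (rule hyperforest_of_forest_labelling[OF q])
      ultimately have "(n, ?es) \<in> hyperforest_instances K"
        using distinct_card[of ?es]
        unfolding hyperforest_instances_def instances_def by simp
      moreover have "m \<le> makespan m (set ?es) (family_coloring A K E)"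
      proof -
        have "family_coloring A K E -` {c} \<inter> E x = E x" using mono by auto
        moreover have "finite e" if "e \<in> set ?es" for e
          using that En finite_subset[of e "{1..n}"] by auto
        ultimately show ?thesis
          using makespan_ge[of "set ?es" "E x" c m "family_coloring A K E"] x c full[OF x] by auto
      qed
      moreover have "opt_makespan m n (set ?es) \<le> 1"
        using f x m by (intro opt_makespan_le[OF _ Pow, of f]) auto
      ultimately show ?thesis using not_competitive_onI r m by auto
    qed
    then show ?thesis by blast
  qed
qed

end
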